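(* Consider an irreducible and positive recurrent Markov chain on a countable state space $\mathbb X$ with stationary distribution $\pi$, and let $k\in\mathbb N_{>0}$. If it is not possible to partition $\mathbb X$ into $k$ sets $W_1,\dots,W_k$ such that $\pi(W_i)=\frac1k$ for each $i$, then $\kappa\neq k$ for any Markov random dynamical system (RDS) representing the Markov chain, where $\kappa$ denotes the $\mathbb P$-a.s. constant size of the random attractor of that RDS (as defined in the context).
   Context: $\mathbb N$ includes $0$. $\mathbb X$ is countable with the discrete topology and the power set $\sigma$-algebra $\mathcal P(\mathbb X)$; compact means finite. RDS: An RDS $(\theta,\varphi)$ on $\mathbb X$ consists of a probability space $(\Omega,\mathcal F,\mathbb P)$; a group $(\theta_n)_{n\in\mathbb Z}$ of bimeasurable measure-preserving maps $\theta_n:\Omega\to\Omega$ with $\theta_0=\mathrm{id}$, $\theta_{n+m}=\theta_n\circ\theta_m$, where $\theta:=\theta_1$ is assumed ergodic with respect to $\mathbb P$; and an $(\mathcal F\otimes\mathcal P(\mathbb N)\otimes\mathcal P(\mathbb X))$-measurable map $\varphi:\Omega\times\mathbb N\times\mathbb X\to\mathbb X$, $(\omega,n,x)\mapsto\varphi^n_\omega(x)$, with $\varphi^0_\omega(x)=x$ and $\varphi^{n+m}_\omega(x)=\varphi^n_{\theta_m\omega}(\varphi^m_\omega(x))$ for all $\omega\in\Omega$, $m,n\in\mathbb N$, $x\in\mathbb X$. Write $\varphi_\omega:=\varphi^1_\omega$; for $K\subset\mathbb X$, $\varphi^n_\omega(K)=\{\varphi^n_\omega(x):x\in K\}$. Markov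 RDS: for $s<t$ in $\mathbb Z$, $\mathcal F_s^t\subset\mathcal F$ is the $\sigma$-algebra generated by the $\mathbb P$-null sets of $\mathcal F$ and the random variables $\omega\mapsto\varphi^n_{\theta_m\omega}(x)$ for $x\in\mathbb X$ and integers $m,n$ with $s\le m\le m+n\le t$. $\mathcal F_{-\infty}^t:=\sigma(\mathcal F_s^t: s<t)$, $\mathcal F_s^\infty:=\sigma(\mathcal F_s^t: t>s)$. The RDS is Markov if $\mathcal F_{-\infty}^0$ and $\mathcal F_0^\infty$ are independent. Then $X_n(\omega)=\varphi^n_\omega(x)$ is a time-homogeneous Markov chain with transition probabilities $P(x,y)=\mathbb P(\varphi_\omega(x)=y)$; the RDS is said to represent (to be an RDS representation of) this Markov chain. A given Markov chain may have many RDS representations. Compact random set: a map $B:\Omega\to\mathcal P(\mathbb X)$ such that $\omega\mapsto\mathbf 1_{B(\omega)}(x)$ is measurable for each $x$ and $B(\omega)$ is finite for $\mathbb P$-a.e. $\omega$. It is invariant if also $\varphi_\omega(B(\omega))=B(\theta\omega)$ $\mathbb P$-a.s. Random attractor: for a Markov RDS representing an irreducible and positive recurrent Markov chain there exists an invariant compact random set $A$, unique up to $\mathbb P$-null sets, with $\omega\mapsto \mathbf 1_{A(\omega)}(x)$ being $\mathcal F_{-\infty}^0$-measurable for each $x$, which is a forward attractor for compact random sets, i.e. for each compact random set $B$, $\mathbb P(\exists N\ \forall n\ge N:\varphi^n_\omega(B(\omega))\subset A(\theta_n\omega))=1$, and a pullback attractor for finite deterministic sets, i.e. for each finite $B\subset\mathbb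 X$, $\mathbb P(\exists N\ \forall n\ge N:\varphi^n_{\theta_{-n}\omega}(B)\subset A(\omega))=1$. This $A$ is called the random attractor. There is a constant $\kappa\in\mathbb N_{>0}$ with $|A(\omega)|=\kappa$ for $\mathbb P$-a.e. $\omega$, and $\mathbb P(x\in A(\omega))=\kappa\pi(x)$ for all $x\in\mathbb X$. *)

theory Defs
  imports "HOL-Probability.Probability"
begin

section \<open>Markov chains on a countable state space\<close>

text \<open>
  A chain is given by its transition kernel \<open>P :: 'x \<Rightarrow> 'x pmf\<close>, with
  \<open>pmf (P x) y\<close> the transition probability from \<open>x\<close> to \<open>y\<close>.
\<close>

primrec path_pmf :: "('x \<Rightarrow> 'x pmf) \<Rightarrow> nat \<Rightarrow> 'x \<Rightarrow> 'x list pmf" \<comment> \<open>law of \<open>[X\<^sub>1, \<dots>, X\<^sub>n]\<close> given \<open>X\<^sub>0 = x\<close>\<close>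
  where
    "path_pmf P 0 x = return_pmf []"
  | "path_pmf P (Suc n) x = bind_pmf (P x) (\<lambda>y. map_pmf (\<lambda>ys. y # ys) (path_pmf P n y))"

text \<open>In \<open>last (x # ys)\<close> the initial state is prepended so that \<open>n = 0\<close> is covered.\<close>

definition irreducible_chain :: "('x \<Rightarrow> 'x pmf) \<Rightarrow> bool" where
  "irreducible_chain P \<longleftrightarrow>
     (\<forall>x y. \<exists>n. measure_pmf.prob (path_pmf P n x) {ys. last (x # ys) = y} > 0)"

text \<open>
  The probability, for the chain started in \<open>x\<close>, that the first return time
  \<open>T\<^sub>x = inf {m \<ge> 1. X\<^sub>m = x}\<close> equals \<open>Suc n\<close>. In the list \<open>ys\<close> the entry \<open>ys ! i\<close> is the
  state at time \<open>i + 1\<close>.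
\<close>

definition first_return_prob :: "('x \<Rightarrow> 'x pmf) \<Rightarrow> 'x \<Rightarrow> nat \<Rightarrow> real" where
  "first_return_prob P x n =
     measure_pmf.prob (path_pmf P (Suc n) x) {ys. ys ! n = x \<and> (\<forall>i<n. ys ! i \<noteq> x)}"

text \<open>For every state, the return time is almost surely finite and has finite expectation.\<close>

definition positive_recurrent :: "('x \<Rightarrow> 'x pmf) \<Rightarrow> bool" where
  "positive_recurrent P \<longleftrightarrow>
     (\<forall>x. first_return_prob P x sums 1 \<and>
          summable (\<lambda>n. real (Suc n) * first_return_prob P x n))"

definition stationary_distribution :: "('x \<Rightarrow> 'x pmf) \<Rightarrow> 'x pmf \<Rightarrow> bool" where
  "stationary_distribution P \<pi> \<longleftrightarrow> bind_pmf \<pi> P = \<pi>"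


section \<open>Random dynamical systems\<close>

text \<open>
  \<open>\<phi> n \<omega> x\<close> is the position at time \<open>n\<close> of the point started in \<open>x\<close>. Bimeasurability of
  \<open>\<theta> n\<close> follows from the group property, \<open>\<theta> (- n)\<close> being the measurable inverse.
\<close>

locale rds = prob_space M
  for M :: "'w measure" +
  fixes \<theta> :: "int \<Rightarrow> 'w \<Rightarrow> 'w"
    and \<phi> :: "nat \<Rightarrow> 'w \<Rightarrow> 'x::countable \<Rightarrow> 'x"
  assumes \<theta>_measurable: "\<theta> n \<in> measurable M M"
    and \<theta>_measure_preserving: "distr M M (\<theta> n) = M"
    and \<theta>_0: "\<omega> \<in> space M \<Longrightarrow> \<theta> 0 \<omega> = \<omega>"
    and \<theta>_add: "\<omega> \<in> space M \<Longrightarrow> \<theta> (n + m) \<omega> = \<theta> n (\<theta> m \<omega>)"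
    and \<theta>_ergodic: "E \<in> sets M \<Longrightarrow> \<theta> 1 -` E \<inter> space M = E \<Longrightarrow> prob E = 0 \<or> prob E = 1"
    and \<phi>_measurable:
      "(\<lambda>(\<omega>, n, x). \<phi> n \<omega> x)
         \<in> measurable (M \<Otimes>\<^sub>M (count_space UNIV \<Otimes>\<^sub>M count_space UNIV)) (count_space UNIV)"
    and \<phi>_0: "\<omega> \<in> space M \<Longrightarrow> \<phi> 0 \<omega> x = x"
    and \<phi>_cocycle: "\<omega> \<in> space M \<Longrightarrow> \<phi> (n + m) \<omega> x = \<phi> n (\<theta> (int m) \<omega>) (\<phi> m \<omega> x)"
begin

text \<open>
  The sub-\<open>\<sigma>\<close>-algebras \<open>\<F>\<^sub>s\<^sup>t\<close>, \<open>\<F>\<^sub>-\<^sub>\<infinity>\<^sup>t\<close> and \<open>\<F>\<^sub>s\<^sup>\<infinity>\<close>. They are represented as \<open>measure\<close>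
  objects of which only the \<open>\<sigma>\<close>-algebra matters (the measure component is zero).
\<close>

definition flow_algebra :: "int \<Rightarrow> int \<Rightarrow> 'w measure" where
  "flow_algebra s t = sigma (space M)
     (null_sets M \<union>
      {(\<lambda>\<omega>. \<phi> n (\<theta> m \<omega>) x) -` S \<inter> space M | n m x S. s \<le> m \<and> m + int n \<le> t})"

definition past_algebra :: "int \<Rightarrow> 'w measure" where
  "past_algebra t = sigma (space M) (\<Union>s\<in>{..<t}. sets (flow_algebra s t))"

definition future_algebra :: "int \<Rightarrow> 'w measure" where
  "future_algebra s = sigma (space M) (\<Union>t\<in>{s<..}. sets (flow_algebra s t))"

definition markov :: bool where
  "markov \<longleftrightarrow> indep_set (sets (past_algebra 0)) (sets (future_algebra 0))"

definition represents :: "('x \<Rightarrow> 'x pmf) \<Rightarrow> bool" where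
  "represents P \<longleftrightarrow> (\<forall>x y. pmf (P x) y = prob {\<omega> \<in> space M. \<phi> 1 \<omega> x = y})"

definition compact_random_set :: "('w \<Rightarrow> 'x set) \<Rightarrow> bool" where
  "compact_random_set B \<longleftrightarrow>
     (\<forall>x. (\<lambda>\<omega>. indicator (B \<omega>) x :: real) \<in> borel_measurable M) \<and>
     (AE \<omega> in M. finite (B \<omega>))"

definition invariant_random_set :: "('w \<Rightarrow> 'x set) \<Rightarrow> bool" where
  "invariant_random_set B \<longleftrightarrow> (AE \<omega> in M. \<phi> 1 \<omega> ` B \<omega> = B (\<theta> 1 \<omega>))"

definition forward_attractor :: "('w \<Rightarrow> 'x set) \<Rightarrow> bool" where
  "forward_attractor A \<longleftrightarrow>
     (\<forall>B. compact_random_set B \<longrightarrow>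
        (AE \<omega> in M. \<exists>N. \<forall>n\<ge>N. \<phi> n \<omega> ` B \<omega> \<subseteq> A (\<theta> (int n) \<omega>)))"

definition pullback_attractor :: "('w \<Rightarrow> 'x set) \<Rightarrow> bool" where
  "pullback_attractor A \<longleftrightarrow>
     (\<forall>B. finite B \<longrightarrow>
        (AE \<omega> in M. \<exists>N. \<forall>n\<ge>N. \<phi> n (\<theta> (- int n) \<omega>) ` B \<subseteq> A \<omega>))"

definition random_attractor :: "('w \<Rightarrow> 'x set) \<Rightarrow> bool" where
  "random_attractor A \<longleftrightarrow>
     compact_random_set A \<and> invariant_random_set A \<and>
     (\<forall>x. (\<lambda>\<omega>. indicator (A \<omega>) x :: real) \<in> borel_measurable (past_algebra 0)) \<and>
     forward_attractor A \<and> pullback_attractor A"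

end

locale markov_rds = rds +
  assumes markov: markov

end

theory Submission
  imports Defs
begin

text \<open>
  Let \<open>\<kappa> = k\<close>. Almost surely the flow is injective on the attractor and every state is eventually
  absorbed by it. The attractor depends on the past and the flow on the future, so by independence
  almost every future has these two properties simultaneously for \<^emph>\<open>every\<close> finite set \<open>K\<close> which is
  a value of the attractor with positive probability. Fix such a future and let two states be
  equivalent if their trajectories coalesce. Each such \<open>K\<close> is a transversal of the equivalence
  classes, so there are \<open>k\<close> classes, and the attractor meets each class \<open>W\<close> in exactly one point.
  Hence \<open>1 = \<bbbE>\<bar>A \<inter> W\<bar> = k \<pi>(W)\<close>.
\<close>

section \<open>Uniqueness of the stationary distribution\<close>

text \<open>Finite mass permits subtraction: \<open>g - f\<close> has integral zero, and a null set
  of counting measure is empty, so the difference vanishes at every point. This is how equality of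
  total masses becomes termwise equality below.\<close>

lemma nn_integral_count_space_eqD:
  fixes f g :: "'a \<Rightarrow> ennreal"
  assumes le: "\<And>x. f x \<le> g x"
    and ge: "(\<integral>\<^sup>+x. g x \<partial>count_space UNIV) \<le> (\<integral>\<^sup>+x. f x \<partial>count_space UNIV)"
    and fin: "(\<integral>\<^sup>+x. f x \<partial>count_space UNIV) \<noteq> \<infinity>"
  shows "f = g"
proof -
  have "(\<integral>\<^sup>+x. g x - f x \<partial>count_space UNIV) =
      (\<integral>\<^sup>+x. g x \<partial>count_space UNIV) - (\<integral>\<^sup>+x. f x \<partial>count_space UNIV)"
    using fin le by (intro nn_integral_diff) auto
  also have "\<dots> = 0"
    using ge fin by (simp add: diff_eq_0_iff_ennreal less_top[symmetric] neq_top_trans)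
  finally have "g x - f x = 0" for x
    by (simp add: nn_integral_0_iff_AE AE_count_space)
  then have "g x \<le> f x" for x
    by (metis diff_eq_0_iff_ennreal diff_eq_0_ennreal ennreal_minus_eq_0)
  with le show ?thesis
    by (intro ext antisym)
qed

lemma stationary_distribution_iff:
  "stationary_distribution P \<mu> \<longleftrightarrow>
     (\<forall>y. (\<integral>\<^sup>+x. ennreal (pmf \<mu> x) * ennreal (pmf (P x) y) \<partial>count_space UNIV) = ennreal (pmf \<mu> y))"
proof -
  have "stationary_distribution P \<mu> \<longleftrightarrow> (\<forall>y. ennreal (pmf (bind_pmf \<mu> P) y) = ennreal (pmf \<mu> y))"
    by (auto simp: stationary_distribution_def pmf_eq_iff)
  then show ?thesis
    by (simp only: ennreal_pmf_bind nn_integral_measure_pmf)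
qed

lemma nn_integral_pmf_UNIV: "(\<integral>\<^sup>+y. ennreal (pmf p y) \<partial>count_space UNIV) = 1"
  using nn_integral_pmf[where p=p and A=UNIV] measure_pmf.emeasure_space_1[of p] by simp

lemma path_pmf_last_closed:
  assumes closed: "\<And>x y. x \<in> S \<Longrightarrow> y \<in> set_pmf (P x) \<Longrightarrow> y \<in> S"
    and "x \<in> S" and "ys \<in> set_pmf (path_pmf P n x)"
  shows "last (x # ys) \<in> S"
  using assms(2,3)
proof (induction n arbitrary: x ys)
  case (Suc n)
  then obtain y zs where "y \<in> set_pmf (P x)" "zs \<in> set_pmf (path_pmf P n y)" "ys = y # zs"
    by auto
  with Suc.IH[of y zs] closed[OF Suc.prems(1)] show ?case
    by simp
qed simp

text \<open>An event of positive probability meets the support of the path law, so some possible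
  path from \<open>x\<close> ends in \<open>y\<close>; a path that starts in \<open>S\<close> cannot
  leave it.\<close>

lemma irreducible_chain_closed:
  assumes "irreducible_chain P" and "x \<in> S"
    and "\<And>x y. x \<in> S \<Longrightarrow> y \<in> set_pmf (P x) \<Longrightarrow> y \<in> S"
  shows "y \<in> S"
proof -
  obtain n where "measure_pmf.prob (path_pmf P n x) {ys. last (x # ys) = y} > 0"
    using assms(1) unfolding irreducible_chain_def by blast
  then have "set_pmf (path_pmf P n x) \<inter> {ys. last (x # ys) = y} \<noteq> {}"
    unfolding measure_pmf_zero_iff[symmetric] by simp
  then obtain ys where "ys \<in> set_pmf (path_pmf P n x)" "last (x # ys) = y"
    by blast
  then show ?thesis
    using path_pmf_last_closed[of S P x ys n] assms(2,3) by blast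
qed

text \<open>
  The pointwise minimum of two stationary distributions is superinvariant, hence invariant because
  its mass is finite. So the set where one distribution exceeds the other is closed under
  transitions.
\<close>

lemma stationary_distribution_unique:
  assumes irr: "irreducible_chain P"
    and \<mu>: "stationary_distribution P \<mu>" and \<nu>: "stationary_distribution P \<nu>"
  shows "\<mu> = \<nu>"
proof -
  define m where "m x = ennreal (min (pmf \<mu> x) (pmf \<nu> x))" for x
  define mP where "mP y = (\<integral>\<^sup>+x. m x * ennreal (pmf (P x) y) \<partial>count_space UNIV)" for y
  have m_\<mu>: "m x \<le> ennreal (pmf \<mu> x)" and m_\<nu>: "m x \<le> ennreal (pmf \<nu> x)" for x
    by (simp_all add: m_def ennreal_leI)
  have mP_\<mu>: "mP y \<le> ennreal (pmf \<mu> y)" for y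
    unfolding mP_def using \<mu>[unfolded stationary_distribution_iff, rule_format, of y, symmetric]
    by (auto intro!: nn_integral_mono mult_right_mono m_\<mu>)
  have mP_\<nu>: "mP y \<le> ennreal (pmf \<nu> y)" for y
    unfolding mP_def using \<nu>[unfolded stationary_distribution_iff, rule_format, of y, symmetric]
    by (auto intro!: nn_integral_mono mult_right_mono m_\<nu>)
  have mP_le: "mP y \<le> m y" for y
    using mP_\<mu>[of y] mP_\<nu>[of y] by (auto simp: m_def min_def)
  \<comment> \<open>Tonelli over two counting measures, then each row of \<open>P\<close> sums to 1:
    a transition step preserves the mass of \<open>m\<close>.\<close>
  have "(\<integral>\<^sup>+y. mP y \<partial>count_space UNIV) =
      (\<integral>\<^sup>+x. (\<integral>\<^sup>+y. m x * ennreal (pmf (P x) y) \<partial>count_space UNIV) \<partial>count_space UNIV)"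
    unfolding mP_def
    by (rule nn_integral_fst_count_space[where f="\<lambda>(y, x). m x * ennreal (pmf (P x) y)", simplified,
          unfolded nn_integral_snd_count_space[where f="\<lambda>(y, x). m x * ennreal (pmf (P x) y)",
            simplified, symmetric]])
  also have "\<dots> = (\<integral>\<^sup>+x. m x \<partial>count_space UNIV)"
    by (simp add: nn_integral_cmult nn_integral_pmf_UNIV)
  finally have mass: "(\<integral>\<^sup>+y. mP y \<partial>count_space UNIV) = (\<integral>\<^sup>+x. m x \<partial>count_space UNIV)" .
  have "(\<integral>\<^sup>+x. m x \<partial>count_space UNIV) \<le> 1"
    using nn_integral_mono[of "count_space UNIV" m "\<lambda>x. ennreal (pmf \<mu> x)"] m_\<mu>
    by (simp add: nn_integral_pmf_UNIV)
  then have mP_eq: "mP = m"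
    by (intro nn_integral_count_space_eqD) (auto simp: mass mP_le top_unique)
  define S where "S = {x. pmf \<nu> x < pmf \<mu> x}"
  have closed: "y \<in> S" if "x \<in> S" "y \<in> set_pmf (P x)" for x y
  proof (rule ccontr)
    \<comment> \<open>Outside \<open>S\<close> the minimum is \<mu>, so the inflow into
      \<open>y\<close> from \<open>m\<close> already equals the inflow from \<mu>. Termwise
      comparison forces \<open>m x = pmf \<mu> x\<close> wherever a transition to \<open>y\<close>
      is possible, whereas on \<open>S\<close> the minimum is the strictly smaller
      \<open>pmf \<nu> x\<close>.\<close>
    assume "y \<notin> S"
    then have "mP y = ennreal (pmf \<mu> y)"
      by (simp add: mP_eq m_def S_def)
    then have "(\<lambda>x. m x * ennreal (pmf (P x) y)) = (\<lambda>x. ennreal (pmf \<mu> x) * ennreal (pmf (P x) y))"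
      using \<mu>[unfolded stationary_distribution_iff, rule_format, of y]
      by (intro nn_integral_count_space_eqD) (auto intro!: mult_right_mono m_\<mu> simp: mP_def)
    then have "m x * ennreal (pmf (P x) y) = ennreal (pmf \<mu> x) * ennreal (pmf (P x) y)"
      by meson
    then have "pmf \<nu> x * pmf (P x) y = pmf \<mu> x * pmf (P x) y"
      using that by (simp add: m_def S_def flip: ennreal_mult)
    then show False
      using that by (simp add: S_def set_pmf_iff)
  qed
  \<comment> \<open>Both total masses are 1. The fact is applied in both orders: an empty
    \<open>S\<close> puts \<mu> below \<nu>, a full \<open>S\<close> puts \<nu> below \<mu>.\<close>
  have eq: "\<nu> = \<mu>" if "\<And>x. pmf \<nu> x \<le> pmf \<mu> x" for \<mu> \<nu> :: "'a pmf"
    using nn_integral_count_space_eqD[of "\<lambda>x. ennreal (pmf \<nu> x)" "\<lambda>x. ennreal (pmf \<mu> x)"] that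
    by (auto simp: nn_integral_pmf_UNIV ennreal_leI pmf_eq_iff dest: fun_cong)
  show ?thesis
  proof (cases "S = {}")
    case True
    then show ?thesis
      using eq[of \<mu> \<nu>] by (auto simp: S_def not_less)
  next
    case False
    then have "y \<in> S" for y
      using irreducible_chain_closed[OF irr, of _ S] closed by blast
    then show ?thesis
      using eq[of \<nu> \<mu>] by (auto simp: S_def less_imp_le)
  qed
qed

section \<open>Coalescence of trajectories\<close>

text \<open>Equality is split over the countably many common values. The algebra \<open>N\<close>
  stays arbitrary because the future algebra, not only \<open>M\<close>, has to be covered.\<close>

lemma pred_eq_countable_family:
  fixes f :: "'a \<Rightarrow> 'x::countable \<Rightarrow> 'x"
  assumes [measurable]: "\<And>x. (\<lambda>\<omega>. f \<omega> x) \<in> measurable N (count_space UNIV)"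
  shows "Measurable.pred N (\<lambda>\<omega>. f \<omega> x = f \<omega> y)"
proof -
  have "(\<lambda>\<omega>. f \<omega> x = f \<omega> y) = (\<lambda>\<omega>. \<exists>z. f \<omega> x = z \<and> f \<omega> y = z)"
    by auto
  also have "Measurable.pred N \<dots>"
    by measurable
  finally show ?thesis .
qed

context rds
begin

lemma AE_shift:
  assumes "AE \<omega> in M. Q \<omega>"
  shows "AE \<omega> in M. Q (\<theta> (int n) \<omega>)"
proof (rule AE_distrD[OF \<theta>_measurable])
  show "AE \<omega> in distr M M (\<theta> (int n)). Q \<omega>"
    unfolding \<theta>_measure_preserving by (rule assms)
qed

lemma space_past_algebra [simp]: "space (past_algebra t) = space M"
  by (simp add: past_algebra_def space_measure_of_conv)

lemma space_future_algebra [simp]: "space (future_algebra t) = space M"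
  by (simp add: future_algebra_def space_measure_of_conv)

lemma flow_measurable_future:
  "(\<lambda>\<omega>. \<phi> n \<omega> x) \<in> measurable (future_algebra 0) (count_space UNIV)"
proof (rule measurableI)
  fix S :: "'x set"
  have "(\<lambda>\<omega>. \<phi> n \<omega> x) -` S \<inter> space M = (\<lambda>\<omega>. \<phi> n (\<theta> 0 \<omega>) x) -` S \<inter> space M"
    by (auto simp: \<theta>_0)
  \<comment> \<open>This is the generator with shift 0. The window ends at \<open>Suc n\<close>
    rather than \<open>n\<close> because \<open>future_algebra 0\<close> collects only windows
    ending strictly after 0, which matters for \<open>n = 0\<close>.\<close>
  also have "\<dots> \<in> sets (flow_algebra 0 (int (Suc n)))"
  proof -
    have "null_sets M \<subseteq> Pow (space M)"
      by (auto dest: null_setsD2 sets.sets_into_space)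
    then show ?thesis
      unfolding flow_algebra_def
      by (subst sets_measure_of)
        (auto intro!: sigma_sets.Basic UnI2 CollectI exI[of _ n] exI[of _ "0::int"] exI[of _ x]
          exI[of _ S])
  qed
  also have "\<dots> \<subseteq> sets (future_algebra 0)"
  proof -
    have "sets (flow_algebra s t) \<subseteq> Pow (space M)" for s t
      using sets.sets_into_space[of _ "flow_algebra s t"] by (auto simp: flow_algebra_def space_measure_of_conv)
    then show ?thesis
      unfolding future_algebra_def
      by (subst sets_measure_of) (auto intro!: sigma_sets.Basic bexI[of _ "int (Suc n)"])
  qed
  finally show "(\<lambda>\<omega>. \<phi> n \<omega> x) -` S \<inter> space (future_algebra 0) \<in> sets (future_algebra 0)"
    by simp
qed simp

definition coalescence :: "'w \<Rightarrow> ('x \<times> 'x) set" where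
  "coalescence \<omega> = {(x, y). \<exists>n. \<phi> n \<omega> x = \<phi> n \<omega> y}"

lemma flow_eq_mono:
  assumes "\<omega> \<in> space M" "\<phi> n \<omega> x = \<phi> n \<omega> y" "n \<le> m"
  shows "\<phi> m \<omega> x = \<phi> m \<omega> y"
  using \<phi>_cocycle[OF assms(1), of "m - n" n] assms(2,3) by simp

lemma equiv_coalescence:
  assumes "\<omega> \<in> space M"
  shows "equiv UNIV (coalescence \<omega>)"
proof (rule equivI)
  show "trans (coalescence \<omega>)"
  proof (rule transI)
    fix x y z assume "(x, y) \<in> coalescence \<omega>" "(y, z) \<in> coalescence \<omega>"
    then obtain m n where "\<phi> m \<omega> x = \<phi> m \<omega> y" "\<phi> n \<omega> y = \<phi> n \<omega> z"
      by (auto simp: coalescence_def)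
    then have "\<phi> (max m n) \<omega> x = \<phi> (max m n) \<omega> z"
      using flow_eq_mono[OF assms, of m x y "max m n"] flow_eq_mono[OF assms, of n y z "max m n"]
      by simp
    then show "(x, z) \<in> coalescence \<omega>"
      by (auto simp: coalescence_def)
  qed
  show "sym (coalescence \<omega>)"
    by (rule symI) (auto simp: coalescence_def eq_commute)
qed (simp_all add: coalescence_def refl_on_def)

text \<open>The two conditions say that \<open>K\<close> is a transversal of the coalescence
  classes. They mention the flow alone and not the attractor, so that for finite \<open>K\<close>
  the event belongs to the future.\<close>

definition transversal_event :: "'x set \<Rightarrow> 'w set" where
  "transversal_event K = {\<omega> \<in> space M. (\<forall>n. inj_on (\<phi> n \<omega>) K) \<and>
     (\<forall>x. \<exists>n. \<exists>y\<in>K. \<phi> n \<omega> x = \<phi> n \<omega> y)}"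

lemma transversal_event_future:
  assumes "finite K"
  shows "transversal_event K \<in> sets (future_algebra 0)"
proof -
  have [measurable]: "Measurable.pred (future_algebra 0) (\<lambda>\<omega>. \<phi> n \<omega> x = \<phi> n \<omega> y)" for n x y
    by (rule pred_eq_countable_family) (rule flow_measurable_future)
  have "{\<omega> \<in> space (future_algebra 0). (\<forall>n. \<forall>x\<in>K. \<forall>y\<in>K. \<phi> n \<omega> x = \<phi> n \<omega> y \<longrightarrow> x = y) \<and>
      (\<forall>x. \<exists>n. \<exists>y\<in>K. \<phi> n \<omega> x = \<phi> n \<omega> y)} \<in> sets (future_algebra 0)"
    using assms by measurable
  then show ?thesis
    by (simp add: transversal_event_def inj_on_def)
qed

text \<open>Sending a point of \<open>K\<close> to its class is a bijection onto the quotient: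
  injective because distinct points of \<open>K\<close> never coalesce, onto because every state
  coalesces with some point of \<open>K\<close>.\<close>

lemma
  assumes \<omega>: "\<omega> \<in> transversal_event K"
  shows transversal_event_card_quotient: "card (UNIV // coalescence \<omega>) = card K"
    and transversal_event_card_class: "W \<in> UNIV // coalescence \<omega> \<Longrightarrow> card (K \<inter> W) = 1"
proof -
  have eq: "equiv UNIV (coalescence \<omega>)"
    using \<omega> by (intro equiv_coalescence) (simp add: transversal_event_def)
  have inj: "x = y" if "x \<in> K" "y \<in> K" "(x, y) \<in> coalescence \<omega>" for x y
    using \<omega> that by (auto simp: transversal_event_def coalescence_def inj_on_def)
  have ex: "\<exists>y\<in>K. (x, y) \<in> coalescence \<omega>" for x
    using \<omega> by (fastforce simp: transversal_event_def coalescence_def)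
  have "bij_betw (\<lambda>x. coalescence \<omega> `` {x}) K (UNIV // coalescence \<omega>)"
  proof (rule bij_betw_imageI)
    show "inj_on (\<lambda>x. coalescence \<omega> `` {x}) K"
      using inj eq_equiv_class[OF _ eq] by (auto intro!: inj_onI)
    show "(\<lambda>x. coalescence \<omega> `` {x}) ` K = UNIV // coalescence \<omega>"
    proof
      show "UNIV // coalescence \<omega> \<subseteq> (\<lambda>x. coalescence \<omega> `` {x}) ` K"
      proof
        fix W assume "W \<in> UNIV // coalescence \<omega>"
        then obtain w where "W = coalescence \<omega> `` {w}"
          by (rule quotientE)
        moreover obtain y where "y \<in> K" "(w, y) \<in> coalescence \<omega>"
          using ex by blast
        ultimately show "W \<in> (\<lambda>x. coalescence \<omega> `` {x}) ` K"
          using equiv_class_eq[OF eq] by (intro image_eqI) simp_all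
      qed
    qed (auto intro: quotientI)
  qed
  from bij_betw_same_card[OF this] show "card (UNIV // coalescence \<omega>) = card K"
    by simp
  assume "W \<in> UNIV // coalescence \<omega>"
  then obtain w where W: "W = coalescence \<omega> `` {w}"
    by (auto simp: quotient_def)
  obtain y where y: "y \<in> K" "(w, y) \<in> coalescence \<omega>"
    using ex by blast
  have "K \<inter> W = {y}"
    using y inj eq unfolding W equiv_def by (auto dest: symD transD)
  then show "card (K \<inter> W) = 1"
    by simp
qed

end

section \<open>The law of the attractor\<close>

text \<open>Records the case \<kappa> = k; the forbidden partition is constructed from it.\<close>

locale sized_attractor = markov_rds M \<theta> \<phi>
  for M :: "'w measure" and \<theta> :: "int \<Rightarrow> 'w \<Rightarrow> 'w"
    and \<phi> :: "nat \<Rightarrow> 'w \<Rightarrow> 'x::countable \<Rightarrow> 'x" +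
  fixes A :: "'w \<Rightarrow> 'x set" and k :: nat
  assumes attractor: "random_attractor A"
    and card_attractor: "AE \<omega> in M. card (A \<omega>) = k"
    and k_pos: "k > 0"
begin

section \<open>Measurability, independence and almost sure behaviour of the attractor\<close>

lemma attractor_past [measurable]: "Measurable.pred (past_algebra 0) (\<lambda>\<omega>. x \<in> A \<omega>)"
proof -
  have [measurable]: "(\<lambda>\<omega>. indicator (A \<omega>) x :: real) \<in> borel_measurable (past_algebra 0)"
    using attractor by (simp add: random_attractor_def)
  have "Measurable.pred (past_algebra 0) (\<lambda>\<omega>. indicator (A \<omega>) x = (1::real))"
    by measurable
  then show ?thesis
    by (simp add: indicator_def)
qed

text \<open>\<open>indep_set\<close> includes that both families consist of events, so the Markov
  property itself makes past and future sets measurable in \<open>M\<close>.\<close>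

lemma past_sets: "E \<in> sets (past_algebra 0) \<Longrightarrow> E \<in> events"
  using markov indep_setD_ev1 unfolding markov_def by blast

lemma future_sets: "E \<in> sets (future_algebra 0) \<Longrightarrow> E \<in> events"
  using markov indep_setD_ev2 unfolding markov_def by blast

lemma indep_past_future:
  assumes "E \<in> sets (past_algebra 0)" "F \<in> sets (future_algebra 0)"
  shows "prob (E \<inter> F) = prob E * prob F"
  using markov unfolding markov_def by (rule indep_setD) (fact assms)+

lemma attractor_measurable [measurable]: "Measurable.pred M (\<lambda>\<omega>. x \<in> A \<omega>)"
  unfolding pred_def using past_sets[OF predE[OF attractor_past[of x]]] by simp

lemma flow_measurable [measurable]: "(\<lambda>\<omega>. \<phi> n \<omega> x) \<in> measurable M (count_space UNIV)"
proof (rule measurableI)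
  show "(\<lambda>\<omega>. \<phi> n \<omega> x) -` S \<inter> space M \<in> events" for S
    using future_sets[OF measurable_sets[OF flow_measurable_future, of S n x]] by simp
qed simp

text \<open>Measure preservation carries invariance and size along the whole orbit. The image of
  \<open>A \<omega>\<close> under the flow is then again a set of \<open>k\<close> points, which
  forces injectivity. Absorption comes from forward attraction of constant singletons.\<close>

lemma AE_attractor:
  "AE \<omega> in M. finite (A \<omega>) \<and> card (A \<omega>) = k \<and> (\<forall>n. inj_on (\<phi> n \<omega>) (A \<omega>)) \<and>
     (\<forall>n. \<phi> n \<omega> ` A \<omega> = A (\<theta> (int n) \<omega>)) \<and> (\<forall>x. \<exists>n. \<exists>y\<in>A \<omega>. \<phi> n \<omega> x = \<phi> n \<omega> y)"
proof -
  have "AE \<omega> in M. \<phi> 1 \<omega> ` A \<omega> = A (\<theta> 1 \<omega>)"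
    using attractor by (simp add: random_attractor_def invariant_random_set_def)
  then have "AE \<omega> in M. \<phi> 1 (\<theta> (int n) \<omega>) ` A (\<theta> (int n) \<omega>) = A (\<theta> 1 (\<theta> (int n) \<omega>))" for n :: nat
    by (rule AE_shift)
  then have inv: "AE \<omega> in M. \<forall>n. \<phi> 1 (\<theta> (int n) \<omega>) ` A (\<theta> (int n) \<omega>) = A (\<theta> 1 (\<theta> (int n) \<omega>))"
    by (simp add: AE_all_countable)
  have card: "AE \<omega> in M. \<forall>n. card (A (\<theta> (int n) \<omega>)) = k"
    using AE_shift[OF card_attractor] by (simp add: AE_all_countable)
  have "AE \<omega> in M. \<exists>N. \<forall>n\<ge>N. \<phi> n \<omega> ` {x} \<subseteq> A (\<theta> (int n) \<omega>)" for x
  proof -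
    have "compact_random_set (\<lambda>_. {x})"
      by (simp add: compact_random_set_def)
    then show ?thesis
      using attractor by (auto simp: random_attractor_def forward_attractor_def)
  qed
  then have att: "AE \<omega> in M. \<forall>x. \<exists>N. \<forall>n\<ge>N. \<phi> n \<omega> ` {x} \<subseteq> A (\<theta> (int n) \<omega>)"
    by (simp add: AE_all_countable)
  show ?thesis
    using inv card att AE_space
  proof eventually_elim
    fix \<omega>
    assume inv: "\<forall>n. \<phi> 1 (\<theta> (int n) \<omega>) ` A (\<theta> (int n) \<omega>) = A (\<theta> 1 (\<theta> (int n) \<omega>))"
      and card: "\<forall>n. card (A (\<theta> (int n) \<omega>)) = k"
      and att: "\<forall>x. \<exists>N. \<forall>n\<ge>N. \<phi> n \<omega> ` {x} \<subseteq> A (\<theta> (int n) \<omega>)"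
      and \<omega>: "\<omega> \<in> space M"
    have card_A: "card (A \<omega>) = k"
      using card[rule_format, of 0] \<theta>_0[OF \<omega>] by simp
    \<comment> \<open>\<open>card\<close> of an infinite set is 0, so positivity of \<open>k\<close>
      gives finiteness.\<close>
    then have fin: "finite (A \<omega>)"
      using k_pos card_ge_0_finite by metis
    have img: "\<phi> n \<omega> ` A \<omega> = A (\<theta> (int n) \<omega>)" for n
    proof (induction n)
      case 0
      then show ?case
        using \<theta>_0[OF \<omega>] \<phi>_0[OF \<omega>] by simp
    next
      case (Suc n)
      have "\<phi> (Suc n) \<omega> ` A \<omega> = \<phi> 1 (\<theta> (int n) \<omega>) ` \<phi> n \<omega> ` A \<omega>"
        using \<phi>_cocycle[OF \<omega>, of 1 n] by (simp add: image_image)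
      also have "\<dots> = A (\<theta> 1 (\<theta> (int n) \<omega>))"
        using Suc inv by simp
      also have "\<dots> = A (\<theta> (int (Suc n)) \<omega>)"
        using \<theta>_add[OF \<omega>, of 1 n] by simp
      finally show ?case .
    qed
    have inj: "inj_on (\<phi> n \<omega>) (A \<omega>)" for n
      using img card card_A fin by (intro eq_card_imp_inj_on) simp_all
    have "\<exists>n. \<exists>y\<in>A \<omega>. \<phi> n \<omega> x = \<phi> n \<omega> y" for x
    proof -
      \<comment> \<open>Once the trajectory of \<open>x\<close> is inside the attractor, invariance
        makes its position also that of a point started in \<open>A \<omega>\<close>.\<close>
      obtain n where "\<phi> n \<omega> x \<in> A (\<theta> (int n) \<omega>)"
        using att by blast
      then show ?thesis
        using img[of n] by blast
    qed
    with card_A fin img inj show "finite (A \<omega>) \<and> card (A \<omega>) = k \<and> (\<forall>n. inj_on (\<phi> n \<omega>) (A \<omega>)) \<and>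
      (\<forall>n. \<phi> n \<omega> ` A \<omega> = A (\<theta> (int n) \<omega>)) \<and> (\<forall>x. \<exists>n. \<exists>y\<in>A \<omega>. \<phi> n \<omega> x = \<phi> n \<omega> y)"
      by blast
  qed
qed

section \<open>Expected numbers of attractor points and the one-point probabilities\<close>

lemma nn_integral_attractor_sum:
  assumes "\<And>x. Measurable.pred M (Q x)"
  shows "(\<integral>\<^sup>+x. emeasure M {\<omega> \<in> space M. x \<in> A \<omega> \<and> Q x \<omega>} \<partial>count_space W) =
      (\<integral>\<^sup>+\<omega>. ennreal (real (card {x \<in> A \<omega>. x \<in> W \<and> Q x \<omega>})) \<partial>M)"
proof -
  note assms [measurable]
  let ?I = "\<lambda>x \<omega>. indicator {\<omega> \<in> space M. x \<in> A \<omega> \<and> Q x \<omega>} \<omega> :: ennreal"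
  have "(\<integral>\<^sup>+x. emeasure M {\<omega> \<in> space M. x \<in> A \<omega> \<and> Q x \<omega>} \<partial>count_space W) =
      (\<integral>\<^sup>+x. (\<integral>\<^sup>+\<omega>. ?I x \<omega> \<partial>M) \<partial>count_space W)"
    by (intro nn_integral_cong) simp
  \<comment> \<open>Tonelli; the inner sum counts points of the attractor. Through \<open>Q\<close>
    the same identity serves for one-step transitions into a state and, with \<open>Q\<close>
    constantly true, for plain membership in \<open>W\<close>.\<close>
  also have "\<dots> = (\<integral>\<^sup>+\<omega>. (\<integral>\<^sup>+x. ?I x \<omega> \<partial>count_space W) \<partial>M)"
    by (rule nn_integral_count_space_nn_integral[symmetric]) auto
  also have "\<dots> = (\<integral>\<^sup>+\<omega>. ennreal (real (card {x \<in> A \<omega>. x \<in> W \<and> Q x \<omega>})) \<partial>M)"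
  proof (rule nn_integral_cong_AE)
    show "AE \<omega> in M. (\<integral>\<^sup>+x. ?I x \<omega> \<partial>count_space W) =
        ennreal (real (card {x \<in> A \<omega>. x \<in> W \<and> Q x \<omega>}))"
      using AE_attractor AE_space
    proof eventually_elim
      fix \<omega>
      assume "finite (A \<omega>) \<and> card (A \<omega>) = k \<and> (\<forall>n. inj_on (\<phi> n \<omega>) (A \<omega>)) \<and>
          (\<forall>n. \<phi> n \<omega> ` A \<omega> = A (\<theta> (int n) \<omega>)) \<and> (\<forall>x. \<exists>n. \<exists>y\<in>A \<omega>. \<phi> n \<omega> x = \<phi> n \<omega> y)"
        and \<omega>: "\<omega> \<in> space M"
      then have fin: "finite {x \<in> A \<omega>. x \<in> W \<and> Q x \<omega>}"
        by simp
      have "(\<integral>\<^sup>+x. ?I x \<omega> \<partial>count_space W) =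
          (\<integral>\<^sup>+x. indicator {x \<in> A \<omega>. x \<in> W \<and> Q x \<omega>} x \<partial>count_space W)"
        using \<omega> by (intro nn_integral_cong) (auto simp: indicator_def)
      also have "\<dots> = emeasure (count_space W) {x \<in> A \<omega>. x \<in> W \<and> Q x \<omega>}"
        by (rule nn_integral_indicator) auto
      also have "\<dots> = ennreal (real (card {x \<in> A \<omega>. x \<in> W \<and> Q x \<omega>}))"
        using fin by (subst emeasure_count_space_finite) (auto simp: ennreal_of_nat_eq_real_of_nat)
      finally show "(\<integral>\<^sup>+x. ?I x \<omega> \<partial>count_space W) =
          ennreal (real (card {x \<in> A \<omega>. x \<in> W \<and> Q x \<omega>}))" .
    qed
  qed
  finally show ?thesis .
qed

text \<open>Membership of \<open>x\<close> in \<open>A\<close> is a past event and the first step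
  from \<open>x\<close> a future one, so independence turns each product into the probability of a
  joint event. The sum is the expected number of attractor points sent to \<open>y\<close>. By
  injectivity and invariance that number is the indicator of
  \<open>y \<in> A (\<theta> 1 \<omega>)\<close>, and \<open>\<theta> 1\<close> preserves
  \<open>M\<close>.\<close>

lemma emeasure_attractor_invariant:
  assumes "represents P"
  shows "(\<integral>\<^sup>+x. emeasure M {\<omega> \<in> space M. x \<in> A \<omega>} * ennreal (pmf (P x) y) \<partial>count_space UNIV) =
      emeasure M {\<omega> \<in> space M. y \<in> A \<omega>}"
proof -
  have "emeasure M {\<omega> \<in> space M. x \<in> A \<omega>} * ennreal (pmf (P x) y) =
      emeasure M {\<omega> \<in> space M. x \<in> A \<omega> \<and> \<phi> 1 \<omega> x = y}" for x
  proof -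
    have "{\<omega> \<in> space M. x \<in> A \<omega>} \<in> sets (past_algebra 0)"
      using attractor_past[of x] by (simp add: pred_def)
    moreover have "{\<omega> \<in> space M. \<phi> 1 \<omega> x = y} \<in> sets (future_algebra 0)"
      using measurable_sets[OF flow_measurable_future, of "{y}" 1 x]
      by (simp add: vimage_def Int_def conj_commute)
    ultimately have "prob ({\<omega> \<in> space M. x \<in> A \<omega>} \<inter> {\<omega> \<in> space M. \<phi> 1 \<omega> x = y}) =
        prob {\<omega> \<in> space M. x \<in> A \<omega>} * pmf (P x) y"
      using assms by (simp add: indep_past_future represents_def)
    moreover have "{\<omega> \<in> space M. x \<in> A \<omega>} \<inter> {\<omega> \<in> space M. \<phi> 1 \<omega> x = y} =
        {\<omega> \<in> space M. x \<in> A \<omega> \<and> \<phi> 1 \<omega> x = y}"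
      by auto
    ultimately show ?thesis
      by (simp add: emeasure_eq_measure ennreal_mult)
  qed
  then have "(\<integral>\<^sup>+x. emeasure M {\<omega> \<in> space M. x \<in> A \<omega>} * ennreal (pmf (P x) y) \<partial>count_space UNIV) =
      (\<integral>\<^sup>+\<omega>. ennreal (real (card {x \<in> A \<omega>. x \<in> UNIV \<and> \<phi> 1 \<omega> x = y})) \<partial>M)"
    by (simp only:) (rule nn_integral_attractor_sum, measurable)
  also have "\<dots> = (\<integral>\<^sup>+\<omega>. indicator {\<omega> \<in> space M. y \<in> A \<omega>} (\<theta> 1 \<omega>) \<partial>M)"
  proof (rule nn_integral_cong_AE)
    show "AE \<omega> in M. ennreal (real (card {x \<in> A \<omega>. x \<in> UNIV \<and> \<phi> 1 \<omega> x = y})) =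
        indicator {\<omega> \<in> space M. y \<in> A \<omega>} (\<theta> 1 \<omega>)"
      using AE_attractor AE_space
    proof eventually_elim
      fix \<omega>
      assume *: "finite (A \<omega>) \<and> card (A \<omega>) = k \<and> (\<forall>n. inj_on (\<phi> n \<omega>) (A \<omega>)) \<and>
          (\<forall>n. \<phi> n \<omega> ` A \<omega> = A (\<theta> (int n) \<omega>)) \<and> (\<forall>x. \<exists>n. \<exists>y\<in>A \<omega>. \<phi> n \<omega> x = \<phi> n \<omega> y)"
        and \<omega>: "\<omega> \<in> space M"
      from * have inj: "inj_on (\<phi> 1 \<omega>) (A \<omega>)"
        by blast
      from * have img: "\<phi> 1 \<omega> ` A \<omega> = A (\<theta> 1 \<omega>)"
        by (metis of_nat_1)
      have sp: "\<theta> 1 \<omega> \<in> space M"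
        using measurable_space[OF \<theta>_measurable[of 1] \<omega>] by simp
      show "ennreal (real (card {x \<in> A \<omega>. x \<in> UNIV \<and> \<phi> 1 \<omega> x = y})) =
          indicator {\<omega> \<in> space M. y \<in> A \<omega>} (\<theta> 1 \<omega>)"
      proof (cases "y \<in> A (\<theta> 1 \<omega>)")
        case True
        then obtain x where "x \<in> A \<omega>" "\<phi> 1 \<omega> x = y"
          unfolding img[symmetric] by (rule imageE) simp
        then have "{x \<in> A \<omega>. x \<in> UNIV \<and> \<phi> 1 \<omega> x = y} = {x}"
          using inj by (auto simp: inj_on_def)
        then show ?thesis
          using True sp by simp
      next
        case False
        then have "{x \<in> A \<omega>. x \<in> UNIV \<and> \<phi> 1 \<omega> x = y} = {}"
          by (auto simp: img[symmetric])
        then show ?thesis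
          using False by (simp only: card.empty) simp
      qed
    qed
  qed
  also have "\<dots> = (\<integral>\<^sup>+\<omega>. indicator {\<omega> \<in> space M. y \<in> A \<omega>} \<omega> \<partial>distr M M (\<theta> 1))"
    by (rule nn_integral_distr[symmetric]) (use \<theta>_measurable[of 1] in auto)
  also have "\<dots> = emeasure M {\<omega> \<in> space M. y \<in> A \<omega>}"
    using \<theta>_measure_preserving[of 1] by simp
  finally show ?thesis .
qed

text \<open>The expected size of \<open>A\<close> is \<open>k\<close>, so division by
  \<open>k\<close> turns the membership probabilities into a distribution. It is stationary by the
  preceding invariance, and an irreducible chain has only one stationary distribution.\<close>

lemma prob_attractor:
  assumes irr: "irreducible_chain P" and rep: "represents P" and \<pi>: "stationary_distribution P \<pi>"
  shows "prob {\<omega> \<in> space M. x \<in> A \<omega>} = real k * pmf \<pi> x"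
proof -
  define p where "p x = prob {\<omega> \<in> space M. x \<in> A \<omega>} / real k" for x
  have p: "ennreal (p x) = emeasure M {\<omega> \<in> space M. x \<in> A \<omega>} * ennreal (1 / real k)" for x
    by (simp add: p_def emeasure_eq_measure flip: ennreal_mult)
  have "(\<integral>\<^sup>+x. emeasure M {\<omega> \<in> space M. x \<in> A \<omega>} \<partial>count_space UNIV) =
      (\<integral>\<^sup>+\<omega>. ennreal (real (card (A \<omega>))) \<partial>M)"
    using nn_integral_attractor_sum[of "\<lambda>_ _. True" UNIV] by simp
  also have "\<dots> = (\<integral>\<^sup>+\<omega>. ennreal (real k) \<partial>M)"
    using card_attractor by (intro nn_integral_cong_AE) auto
  also have "\<dots> = ennreal (real k)"
    by (simp add: emeasure_space_1)
  finally have "(\<integral>\<^sup>+x. ennreal (p x) \<partial>count_space UNIV) = 1"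
    using k_pos by (simp add: p nn_integral_multc flip: ennreal_mult)
  then have pmf: "pmf (embed_pmf p) x = p x" for x
    by (intro pmf_embed_pmf) (simp add: p_def)
  have "stationary_distribution P (embed_pmf p)"
    unfolding stationary_distribution_iff pmf
  proof
    fix y
    have "(\<integral>\<^sup>+x. ennreal (p x) * ennreal (pmf (P x) y) \<partial>count_space UNIV) =
        (\<integral>\<^sup>+x. (emeasure M {\<omega> \<in> space M. x \<in> A \<omega>} * ennreal (pmf (P x) y)) * ennreal (1 / real k)
          \<partial>count_space UNIV)"
      by (simp only: p mult_ac)
    also have "\<dots> = ennreal (p y)"
      by (simp only: p nn_integral_multc measurable_count_space emeasure_attractor_invariant[OF rep]
          borel_measurable_count_space)
    finally show "(\<integral>\<^sup>+x. ennreal (p x) * ennreal (pmf (P x) y) \<partial>count_space UNIV) = ennreal (p y)" .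
  qed
  then have "embed_pmf p = \<pi>"
    using stationary_distribution_unique[OF irr _ \<pi>] by blast
  then have "pmf \<pi> x = p x"
    using pmf by metis
  then show ?thesis
    using k_pos by (simp add: p_def)
qed

section \<open>Attractor values and the partition into classes of equal mass\<close>

definition attractor_values :: "'x set set" where
  "attractor_values = {K. finite K \<and> prob {\<omega> \<in> space M. A \<omega> = K} \<noteq> 0}"

lemma attractor_eq_past: "{\<omega> \<in> space M. A \<omega> = K} \<in> sets (past_algebra 0)"
proof -
  have "{\<omega> \<in> space (past_algebra 0). \<forall>x. x \<in> A \<omega> \<longleftrightarrow> x \<in> K} \<in> sets (past_algebra 0)"
    by measurable
  then show ?thesis
    by (simp add: set_eq_iff)
qed

text \<open>A countable space has only countably many finite subsets, so those attained with
  probability zero can be discarded together.\<close>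

lemma AE_attractor_values: "AE \<omega> in M. A \<omega> \<in> attractor_values"
proof -
  have "AE \<omega> in M. \<forall>K\<in>{K. finite K \<and> K \<notin> attractor_values}. A \<omega> \<noteq> K"
  proof (rule AE_ball_countable')
    show "countable {K :: 'x set. finite K \<and> K \<notin> attractor_values}"
      by (rule countable_subset[OF _ countable_Collect_finite]) auto
    fix K assume "K \<in> {K. finite K \<and> K \<notin> attractor_values}"
    then have "prob {\<omega> \<in> space M. A \<omega> = K} = 0"
      by (simp add: attractor_values_def)
    then show "AE \<omega> in M. A \<omega> \<noteq> K"
      using past_sets[OF attractor_eq_past[of K]] prob_eq_0[of "{\<omega> \<in> space M. A \<omega> = K}"]
      by (auto elim: eventually_mono)
  qed
  with AE_attractor show ?thesis
    by eventually_elim blast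
qed

text \<open>On the past event \<open>A \<omega> = K\<close>, the future event
  \<open>transversal_event K\<close> holds almost surely. Independence factors the probability of
  their intersection, and the nonzero probability of the past event cancels: a property of the
  random attractor becomes one of the fixed set \<open>K\<close>.\<close>

lemma AE_transversal_event:
  assumes K: "K \<in> attractor_values"
  shows "AE \<omega> in M. \<omega> \<in> transversal_event K"
proof -
  let ?E = "{\<omega> \<in> space M. A \<omega> = K}"
  have fin: "finite K" and pos: "prob ?E \<noteq> 0"
    using K by (simp_all add: attractor_values_def)
  note past = attractor_eq_past[of K] and future = transversal_event_future[OF fin]
  have "prob (?E \<inter> transversal_event K) = prob ?E"
  proof (rule measure_eq_AE)
    show "AE \<omega> in M. \<omega> \<in> ?E \<inter> transversal_event K \<longleftrightarrow> \<omega> \<in> ?E"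
      using AE_attractor AE_space by eventually_elim (auto simp: transversal_event_def)
  qed (use past future in \<open>auto intro: past_sets future_sets\<close>)
  then have "prob (transversal_event K) = 1"
    using indep_past_future[OF past future] pos by simp
  then show ?thesis
    using prob_eq_1 future_sets[OF future] by blast
qed

lemma equal_mass_partition:
  assumes "irreducible_chain P" and "represents P" and "stationary_distribution P \<pi>"
  shows "\<exists>\<W>. partition_on UNIV \<W> \<and> card \<W> = k \<and>
           (\<forall>W\<in>\<W>. measure_pmf.prob \<pi> W = 1 / real k)"
proof -
  have "AE \<omega> in M. \<forall>K\<in>attractor_values. \<omega> \<in> transversal_event K"
  proof (rule AE_ball_countable')
    show "countable attractor_values"
      by (rule countable_subset[OF _ countable_Collect_finite]) (auto simp: attractor_values_def)
  qed (rule AE_transversal_event)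
  moreover have "AE \<omega> in M. card (A \<omega>) = k \<and> A \<omega> \<in> attractor_values"
    using card_attractor AE_attractor_values by eventually_elim simp
  ultimately have "AE \<omega> in M. \<omega> \<in> space M \<and> (\<forall>K\<in>attractor_values. \<omega> \<in> transversal_event K) \<and>
      card (A \<omega>) = k \<and> A \<omega> \<in> attractor_values"
    using AE_space by eventually_elim simp
  \<comment> \<open>One typical \<open>\<omega>\<^sub>0\<close> is frozen, which makes its
    coalescence classes deterministic sets. Since \<open>A \<omega>\<^sub>0\<close> is itself an
    attractor value with \<open>k\<close> points, it also fixes the number of classes.\<close>
  from eventually_happens'[OF ae_filter_bot this] obtain \<omega>\<^sub>0 where \<omega>\<^sub>0: "\<omega>\<^sub>0 \<in> space M"
      "\<And>K. K \<in> attractor_values \<Longrightarrow> \<omega>\<^sub>0 \<in> transversal_event K"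
      "card (A \<omega>\<^sub>0) = k" "A \<omega>\<^sub>0 \<in> attractor_values"
    by blast
  let ?\<W> = "UNIV // coalescence \<omega>\<^sub>0"
  have "measure_pmf.prob \<pi> W = 1 / real k" if W: "W \<in> ?\<W>" for W
  proof -
    have "ennreal (real k * measure_pmf.prob \<pi> W) =
        ennreal (real k) * (\<integral>\<^sup>+x. ennreal (pmf \<pi> x) \<partial>count_space W)"
      by (simp add: nn_integral_pmf measure_pmf.emeasure_eq_measure ennreal_mult)
    also have "\<dots> = (\<integral>\<^sup>+x. ennreal (real k) * ennreal (pmf \<pi> x) \<partial>count_space W)"
      by (rule nn_integral_cmult[symmetric]) simp
    also have "\<dots> = (\<integral>\<^sup>+x. emeasure M {\<omega> \<in> space M. x \<in> A \<omega>} \<partial>count_space W)"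
      by (simp add: emeasure_eq_measure prob_attractor[OF assms] ennreal_mult)
    also have "\<dots> = (\<integral>\<^sup>+\<omega>. ennreal (real (card (A \<omega> \<inter> W))) \<partial>M)"
      using nn_integral_attractor_sum[of "\<lambda>_ _. True" W] by (simp add: Int_def)
    also have "\<dots> = (\<integral>\<^sup>+\<omega>. 1 \<partial>M)"
    proof (rule nn_integral_cong_AE)
      show "AE \<omega> in M. ennreal (real (card (A \<omega> \<inter> W))) = 1"
        using AE_attractor_values
        by eventually_elim (simp add: transversal_event_card_class[OF \<omega>\<^sub>0(2) W])
    qed
    also have "\<dots> = 1"
      by (simp add: emeasure_space_1)
    finally show ?thesis
      using k_pos by (simp add: field_simps)
  qed
  moreover have "card ?\<W> = k"
    using transversal_event_card_quotient[OF \<omega>\<^sub>0(2)[OF \<omega>\<^sub>0(4)]] \<omega>\<^sub>0(3) by simp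
  moreover have "partition_on UNIV ?\<W>"
    by (rule partition_on_quotient[OF equiv_coalescence[OF \<omega>\<^sub>0(1)]])
  ultimately show ?thesis
    by blast
qed

end

theorem corollary3p15:
  fixes P :: "'x::countable \<Rightarrow> 'x pmf"
    and \<pi> :: "'x pmf"
    and k \<kappa> :: nat
    and M :: "'w measure"
    and \<theta> :: "int \<Rightarrow> 'w \<Rightarrow> 'w"
    and \<phi> :: "nat \<Rightarrow> 'w \<Rightarrow> 'x \<Rightarrow> 'x"
    and A :: "'w \<Rightarrow> 'x set"
  assumes "irreducible_chain P"
    and "positive_recurrent P"
    and "stationary_distribution P \<pi>"
    and "k > 0"
    and "\<not> (\<exists>\<W>. partition_on UNIV \<W> \<and> card \<W> = k \<and>
               (\<forall>W\<in>\<W>. measure_pmf.prob \<pi> W = 1 / real k))"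
    and "markov_rds M \<theta> \<phi>"
    and "rds.represents M \<phi> P"
    and "rds.random_attractor M \<theta> \<phi> A"
    and "AE \<omega> in M. card (A \<omega>) = \<kappa>"
  shows "\<kappa> \<noteq> k"
proof
  assume "\<kappa> = k"
  with assms have "sized_attractor M \<theta> \<phi> A k"
    by (simp add: sized_attractor_def sized_attractor_axioms_def markov_rds_def)
  from sized_attractor.equal_mass_partition[OF this assms(1,7,3)] assms(5) show False
    by contradiction
qed

end
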